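(* Let $(X,\|\cdot\|)$ be a finite dimensional real normed linear space, let $(G,p)$ be a well-positioned and $\mathbb{Z}_2$-symmetric bar-joint framework in $(X,\|\cdot\|)$ and let $(H,p)$ be a $\mathbb{Z}_2$-symmetric subframework of $(G,p)$, with quotient graph $H_0$. (i) If $(G,p)$ is symmetrically isostatic then $$|E(H_0)|\le(\dim X)|V(H_0)|-\dim\mathcal{T}_1(H,p),$$ and if $H_0$ is balanced in $G_0$ then $$|E(H_0)|\le(\dim X)|V(H_0)|-\dim\mathcal{T}(H_0,p).$$ (ii) If $(G,p)$ is anti-symmetrically isostatic then $$|E(H_0)|\le(\dim X)|V(H_0)|-\dim\mathcal{T}_2(H,p),$$ and if $H_0$ is balanced in $G_0$ then $$|E(H_0)|\le(\dim X)|V(H_0)|-\dim\mathcal{T}(H_0,p).$$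
   Context: **Graphs.** $G=(V,E)$ is a finite simple undirected graph with a homomorphism $\theta:\mathbb{Z}_2\to\mathrm{Aut}(G)$, $\mathbb{Z}_2=\{1,-1\}$, acting freely on $V$; write $-v=\theta(-1)v$ (so $v\neq -v$), $-e=(-v)(-w)$ for $e=vw$. Edges with $e=-e$ (fixed edges) are allowed. $[v]=\{v,-v\}$ and $[e]=\{e,-e\}$ are vertex and edge orbits. The quotient graph $G_0$ has the vertex orbits as vertices and the edge orbits as edges, $[e]$ being incident to $[v]$ if $e$ is incident to $v$ or $-v$ (fixed edges give loops). For a $\theta$-invariant subgraph $H$ of $G$, $H_0$ denotes its quotient graph, a subgraph of $G_0$. Given representatives $\tilde V_0$ for the vertex orbits, the gain is $\psi_{[e]}=1$ if $e$ or $-e$ joins two vertices of $\tilde V_0$, and $-1$ otherwise. A subgraph of $G_0$ is balanced if every cycle in it (loops and pairs of parallel edges included) has gain product $1$; this is independent of $\tilde V_0$. **Frameworks.** A bar-joint framework is $(G,p)$ with $p\in X^{|V|}$, $p_v\ne p_w$ for $vw\in E$. It is well-positioned if $f_G(x)=(\|x_v-x_w\|)_{vw\in E}$ is differentiable at $p$. A $\mathbb{Z}_2$-symmetric subframework $(H,p)$ is given by a $\theta$-invariant subgraph $H$ with the restriction of $p$ to $V(H)$. $(G,p)$ is $\mathbb{Z}_2$-symmetric with respect to $\theta$ and a representation $\tau:\mathbb{Z}_2\to\mathrm{Isom}(X,\|\cdot\|)$ (linear isometries) if $\tau(-1)p_v=p_{-v}$ for all $v$. An infinitesimal flex is $u\in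 X^{|V|}$ with directional derivative $D_uf_G(p)=0$. A rigid motion of $X$ is a family of continuous paths $\{\alpha_x:[-1,1]\to X\}_{x\in X}$, differentiable at $0$, with $\alpha_x(0)=x$ and $\|\alpha_x(t)-\alpha_y(t)\|=\|x-y\|$ for all $x,y,t$; a flex is trivial if it equals $(\alpha'_{p_v}(0))_v$ for some rigid motion. $\mathcal{T}(G,p)$ is the space of trivial flexes; $\mathcal{T}_1(G,p)$ (resp. $\mathcal{T}_2(G,p)$) the subspace of symmetric (resp. anti-symmetric) ones, where $u$ is symmetric if $u_{-v}=\tau(-1)u_v$ for all $v$ and anti-symmetric if $u_{-v}=-\tau(-1)u_v$ for all $v$. $(G,p)$ is (anti-)symmetrically infinitesimally rigid if every (anti-)symmetric infinitesimal flex is trivial, and (anti-)symmetrically isostatic if in addition no $(H,p)$ with $H\neq G$ a $\theta$-invariant spanning subgraph of $G$ is (anti-)symmetrically infinitesimally rigid. **The framework $(H_0,p)$.** If $H_0$ is balanced, there is a choice of vertex orbit representatives for which all edges of $H_0$ have gain $1$. $H_0$ is then identified with the subgraph of $H$ induced on the chosen representatives, and $(H_0,p)$ is the corresponding subframework of $(H,p)$. *)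

theory Defs
  imports "HOL-Analysis.Analysis"
begin

text \<open>Vertex sets are arbitrary subsets of a finite type, so that a graph, its subgraphs and the
  graphs induced on vertex orbit representatives all have the same type.\<close>

datatype 'v graph = Graph (verts: "'v set") (edges: "'v set set")

definition simple_graph :: "'v graph \<Rightarrow> bool" where
  "simple_graph G \<longleftrightarrow> (\<forall>e\<in>edges G. e \<subseteq> verts G \<and> card e = 2)"

definition subgraph :: "'v graph \<Rightarrow> 'v graph \<Rightarrow> bool" where
  "subgraph H G \<longleftrightarrow> simple_graph H \<and> verts H \<subseteq> verts G \<and> edges H \<subseteq> edges G"

definition graph_automorphism :: "'v graph \<Rightarrow> ('v \<Rightarrow> 'v) \<Rightarrow> bool" where
  "graph_automorphism G f \<longleftrightarrow> bij_betw f (verts G) (verts G) \<and>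
     (\<forall>v\<in>verts G. \<forall>w\<in>verts G. {v, w} \<in> edges G \<longleftrightarrow> {f v, f w} \<in> edges G)"

definition Z2 :: "int set" where
  "Z2 = {1, -1}"

definition free_Z2_action :: "(int \<Rightarrow> 'v \<Rightarrow> 'v) \<Rightarrow> 'v graph \<Rightarrow> bool" where
  "free_Z2_action \<theta> G \<longleftrightarrow>
     (\<forall>s\<in>Z2. graph_automorphism G (\<theta> s)) \<and>
     (\<forall>s\<in>Z2. \<forall>t\<in>Z2. \<forall>v\<in>verts G. \<theta> (s * t) v = \<theta> s (\<theta> t v)) \<and>
     (\<forall>s\<in>Z2. s \<noteq> 1 \<longrightarrow> (\<forall>v\<in>verts G. \<theta> s v \<noteq> v))"

definition Z2_invariant :: "(int \<Rightarrow> 'v \<Rightarrow> 'v) \<Rightarrow> 'v graph \<Rightarrow> bool" where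
  "Z2_invariant \<theta> H \<longleftrightarrow>
     (\<forall>s\<in>Z2. \<theta> s ` verts H = verts H \<and> (\<lambda>e. \<theta> s ` e) ` edges H = edges H)"

definition vertex_orbit :: "(int \<Rightarrow> 'v \<Rightarrow> 'v) \<Rightarrow> 'v \<Rightarrow> 'v set" where
  "vertex_orbit \<theta> v = {v, \<theta> (-1) v}"

definition edge_orbit :: "(int \<Rightarrow> 'v \<Rightarrow> 'v) \<Rightarrow> 'v set \<Rightarrow> 'v set set" where
  "edge_orbit \<theta> e = {e, \<theta> (-1) ` e}"

text \<open>The quotient graph is a multigraph: the vertices incident to an edge orbit \<open>F\<close> are
  \<open>quot_ends \<theta> F\<close>, which is a singleton exactly when \<open>F\<close> is a loop.\<close>

definition quot_verts :: "(int \<Rightarrow> 'v \<Rightarrow> 'v) \<Rightarrow> 'v graph \<Rightarrow> 'v set set" where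
  "quot_verts \<theta> H = vertex_orbit \<theta> ` verts H"

definition quot_edges :: "(int \<Rightarrow> 'v \<Rightarrow> 'v) \<Rightarrow> 'v graph \<Rightarrow> 'v set set set" where
  "quot_edges \<theta> H = edge_orbit \<theta> ` edges H"

definition quot_ends :: "(int \<Rightarrow> 'v \<Rightarrow> 'v) \<Rightarrow> 'v set set \<Rightarrow> 'v set set" where
  "quot_ends \<theta> F = vertex_orbit \<theta> ` (\<Union>F)"

text \<open>Cycles of length 1 are loops, cycles of length 2 are pairs of parallel edges.\<close>

definition quot_cycle ::
  "(int \<Rightarrow> 'v \<Rightarrow> 'v) \<Rightarrow> 'v graph \<Rightarrow> 'v set list \<Rightarrow> 'v set set list \<Rightarrow> bool" where
  "quot_cycle \<theta> H vs fs \<longleftrightarrow>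
     fs \<noteq> [] \<and> length vs = length fs \<and> distinct vs \<and> distinct fs \<and>
     set vs \<subseteq> quot_verts \<theta> H \<and> set fs \<subseteq> quot_edges \<theta> H \<and>
     (\<forall>i<length fs. quot_ends \<theta> (fs ! i) = {vs ! i, vs ! (Suc i mod length vs)})"

definition orbit_representatives :: "(int \<Rightarrow> 'v \<Rightarrow> 'v) \<Rightarrow> 'v graph \<Rightarrow> 'v set \<Rightarrow> bool" where
  "orbit_representatives \<theta> G R \<longleftrightarrow>
     R \<subseteq> verts G \<and> (\<forall>v\<in>verts G. \<exists>!w. w \<in> R \<and> w \<in> vertex_orbit \<theta> v)"

definition gain :: "'v set \<Rightarrow> 'v set set \<Rightarrow> int" where
  "gain R F = (if \<exists>e\<in>F. e \<subseteq> R then 1 else -1)"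

definition balanced :: "(int \<Rightarrow> 'v \<Rightarrow> 'v) \<Rightarrow> 'v set \<Rightarrow> 'v graph \<Rightarrow> bool" where
  "balanced \<theta> R H \<longleftrightarrow> (\<forall>vs fs. quot_cycle \<theta> H vs fs \<longrightarrow> prod_list (map (gain R) fs) = 1)"

definition unit_gain_representatives ::
  "(int \<Rightarrow> 'v \<Rightarrow> 'v) \<Rightarrow> 'v graph \<Rightarrow> 'v set \<Rightarrow> bool" where
  "unit_gain_representatives \<theta> H S \<longleftrightarrow>
     orbit_representatives \<theta> H S \<and> (\<forall>F\<in>quot_edges \<theta> H. gain S F = 1)"

definition induced_subgraph :: "'v graph \<Rightarrow> 'v set \<Rightarrow> 'v graph" where
  "induced_subgraph H S = Graph (verts H \<inter> S) {e \<in> edges H. e \<subseteq> S}"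

text \<open>A placement of a graph with vertex set \<open>U\<close> is given by the coordinates in \<open>U\<close> of a vector
  \<open>p :: 'x ^ 'v\<close>; the other coordinates are never used. Restricting a framework to a subgraph
  therefore leaves \<open>p\<close> unchanged. Velocity vectors, by contrast, are required to vanish
  outside \<open>U\<close>, so that they range over a copy of the space of \<open>U\<close>-indexed families and dimensions
  of spaces of flexes are the intended ones.\<close>

definition velocities :: "'v set \<Rightarrow> ('x::real_normed_vector ^ 'v::finite) set" where
  "velocities U = {u. \<forall>v. v \<notin> U \<longrightarrow> u $ v = 0}"

definition edge_length :: "'x::real_normed_vector ^ 'v::finite \<Rightarrow> 'v set \<Rightarrow> real" where
  "edge_length x e = (THE l. \<exists>v w. e = {v, w} \<and> l = norm (x $ v - x $ w))"

lemma edge_length_pair [simp]: "edge_length x {v, w} = norm (x $ v - x $ w)"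
  unfolding edge_length_def
  by (rule the_equality) (auto simp: doubleton_eq_iff norm_minus_commute)

definition rigidity_map ::
  "'v graph \<Rightarrow> 'x::real_normed_vector ^ 'v::finite \<Rightarrow> real ^ ('v set)" where
  "rigidity_map G x = (\<chi> e. if e \<in> edges G then edge_length x e else 0)"

definition framework :: "'v graph \<Rightarrow> 'x::real_normed_vector ^ 'v::finite \<Rightarrow> bool" where
  "framework G p \<longleftrightarrow> simple_graph G \<and> (\<forall>v w. {v, w} \<in> edges G \<longrightarrow> p $ v \<noteq> p $ w)"

definition well_positioned :: "'v graph \<Rightarrow> 'x::real_normed_vector ^ 'v::finite \<Rightarrow> bool" where
  "well_positioned G p \<longleftrightarrow> rigidity_map G differentiable (at p)"

definition Z2_representation :: "(int \<Rightarrow> 'x \<Rightarrow> 'x::real_normed_vector) \<Rightarrow> bool" where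
  "Z2_representation \<tau> \<longleftrightarrow>
     (\<forall>s\<in>Z2. linear (\<tau> s) \<and> bij (\<tau> s) \<and> (\<forall>x. norm (\<tau> s x) = norm x)) \<and>
     (\<forall>s\<in>Z2. \<forall>t\<in>Z2. \<tau> (s * t) = \<tau> s \<circ> \<tau> t)"

definition Z2_symmetric ::
  "(int \<Rightarrow> 'v \<Rightarrow> 'v) \<Rightarrow> (int \<Rightarrow> 'x \<Rightarrow> 'x) \<Rightarrow> 'v graph \<Rightarrow> 'x::real_normed_vector ^ 'v::finite \<Rightarrow> bool"
  where
  "Z2_symmetric \<theta> \<tau> G p \<longleftrightarrow> (\<forall>v\<in>verts G. \<tau> (-1) (p $ v) = p $ \<theta> (-1) v)"

definition infinitesimal_flex ::
  "'v graph \<Rightarrow> 'x::real_normed_vector ^ 'v::finite \<Rightarrow> 'x ^ 'v \<Rightarrow> bool" where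
  "infinitesimal_flex G p u \<longleftrightarrow> u \<in> velocities (verts G) \<and>
     ((\<lambda>t. rigidity_map G (p + t *\<^sub>R u)) has_vector_derivative 0) (at 0)"

definition rigid_motion :: "('x \<Rightarrow> real \<Rightarrow> 'x::real_normed_vector) \<Rightarrow> bool" where
  "rigid_motion \<alpha> \<longleftrightarrow>
     (\<forall>x. continuous_on {-1..1} (\<alpha> x) \<and> \<alpha> x differentiable (at 0) \<and> \<alpha> x 0 = x) \<and>
     (\<forall>x y. \<forall>t\<in>{-1..1}. norm (\<alpha> x t - \<alpha> y t) = norm (x - y))"

text \<open>For a well-positioned framework the velocities of a rigid motion are automatically an
  infinitesimal flex, by the chain rule, so this need not be demanded here.\<close>

definition trivial_flexes ::
  "'v graph \<Rightarrow> 'x::real_normed_vector ^ 'v::finite \<Rightarrow> ('x ^ 'v) set" where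
  "trivial_flexes G p = {u \<in> velocities (verts G).
     \<exists>\<alpha>. rigid_motion \<alpha> \<and> (\<forall>v\<in>verts G. u $ v = vector_derivative (\<alpha> (p $ v)) (at 0))}"

definition symmetric_velocity ::
  "(int \<Rightarrow> 'v \<Rightarrow> 'v) \<Rightarrow> (int \<Rightarrow> 'x \<Rightarrow> 'x) \<Rightarrow> 'v graph \<Rightarrow> 'x::real_normed_vector ^ 'v::finite \<Rightarrow> bool"
  where
  "symmetric_velocity \<theta> \<tau> G u \<longleftrightarrow> (\<forall>v\<in>verts G. u $ \<theta> (-1) v = \<tau> (-1) (u $ v))"

definition antisymmetric_velocity ::
  "(int \<Rightarrow> 'v \<Rightarrow> 'v) \<Rightarrow> (int \<Rightarrow> 'x \<Rightarrow> 'x) \<Rightarrow> 'v graph \<Rightarrow> 'x::real_normed_vector ^ 'v::finite \<Rightarrow> bool"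
  where
  "antisymmetric_velocity \<theta> \<tau> G u \<longleftrightarrow> (\<forall>v\<in>verts G. u $ \<theta> (-1) v = - \<tau> (-1) (u $ v))"

definition symmetric_trivial_flexes ::
  "(int \<Rightarrow> 'v \<Rightarrow> 'v) \<Rightarrow> (int \<Rightarrow> 'x \<Rightarrow> 'x) \<Rightarrow> 'v graph \<Rightarrow> 'x::real_normed_vector ^ 'v::finite \<Rightarrow>
     ('x ^ 'v) set" where
  "symmetric_trivial_flexes \<theta> \<tau> G p = {u \<in> trivial_flexes G p. symmetric_velocity \<theta> \<tau> G u}"

definition antisymmetric_trivial_flexes ::
  "(int \<Rightarrow> 'v \<Rightarrow> 'v) \<Rightarrow> (int \<Rightarrow> 'x \<Rightarrow> 'x) \<Rightarrow> 'v graph \<Rightarrow> 'x::real_normed_vector ^ 'v::finite \<Rightarrow>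
     ('x ^ 'v) set" where
  "antisymmetric_trivial_flexes \<theta> \<tau> G p =
     {u \<in> trivial_flexes G p. antisymmetric_velocity \<theta> \<tau> G u}"

definition symmetrically_rigid ::
  "(int \<Rightarrow> 'v \<Rightarrow> 'v) \<Rightarrow> (int \<Rightarrow> 'x \<Rightarrow> 'x) \<Rightarrow> 'v graph \<Rightarrow> 'x::real_normed_vector ^ 'v::finite \<Rightarrow> bool"
  where
  "symmetrically_rigid \<theta> \<tau> G p \<longleftrightarrow>
     (\<forall>u. infinitesimal_flex G p u \<and> symmetric_velocity \<theta> \<tau> G u \<longrightarrow> u \<in> trivial_flexes G p)"

definition antisymmetrically_rigid ::
  "(int \<Rightarrow> 'v \<Rightarrow> 'v) \<Rightarrow> (int \<Rightarrow> 'x \<Rightarrow> 'x) \<Rightarrow> 'v graph \<Rightarrow> 'x::real_normed_vector ^ 'v::finite \<Rightarrow> bool"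
  where
  "antisymmetrically_rigid \<theta> \<tau> G p \<longleftrightarrow>
     (\<forall>u. infinitesimal_flex G p u \<and> antisymmetric_velocity \<theta> \<tau> G u \<longrightarrow> u \<in> trivial_flexes G p)"

definition symmetrically_isostatic ::
  "(int \<Rightarrow> 'v \<Rightarrow> 'v) \<Rightarrow> (int \<Rightarrow> 'x \<Rightarrow> 'x) \<Rightarrow> 'v graph \<Rightarrow> 'x::real_normed_vector ^ 'v::finite \<Rightarrow> bool"
  where
  "symmetrically_isostatic \<theta> \<tau> G p \<longleftrightarrow> symmetrically_rigid \<theta> \<tau> G p \<and>
     \<not> (\<exists>H. subgraph H G \<and> verts H = verts G \<and> H \<noteq> G \<and> Z2_invariant \<theta> H \<and>
            symmetrically_rigid \<theta> \<tau> H p)"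

definition antisymmetrically_isostatic ::
  "(int \<Rightarrow> 'v \<Rightarrow> 'v) \<Rightarrow> (int \<Rightarrow> 'x \<Rightarrow> 'x) \<Rightarrow> 'v graph \<Rightarrow> 'x::real_normed_vector ^ 'v::finite \<Rightarrow> bool"
  where
  "antisymmetrically_isostatic \<theta> \<tau> G p \<longleftrightarrow> antisymmetrically_rigid \<theta> \<tau> G p \<and>
     \<not> (\<exists>H. subgraph H G \<and> verts H = verts G \<and> H \<noteq> G \<and> Z2_invariant \<theta> H \<and>
            antisymmetrically_rigid \<theta> \<tau> H p)"

text \<open>The representatives used to identify the quotient of a balanced subgraph with an induced
  subgraph are not unique, and the space of trivial flexes of the resulting framework can depend
  on them if the quotient is disconnected. They are therefore quantified universally; the
  following lemma shows that they exist.\<close>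

lemma balanced_imp_unit_gain_representatives:
  fixes H :: "'v graph"
  assumes act: "free_Z2_action \<theta> G" and R: "orbit_representatives \<theta> G R"
    and HG: "subgraph H G" and inv: "Z2_invariant \<theta> H" and bal: "balanced \<theta> R H"
  shows "\<exists>S. unit_gain_representatives \<theta> H S"
proof -
  define m where "m = \<theta> (-1)"
  define V where "V = verts H"
  define E where "E = edges H"
  have VG: "V \<subseteq> verts G" using HG by (simp add: subgraph_def V_def)
  have EV: "a \<in> V" "b \<in> V" "a \<noteq> b" if "{a, b} \<in> E" for a b
    using HG that unfolding subgraph_def simple_graph_def V_def E_def by (auto simp: card_2_iff)
  have E2: "\<exists>a b. e = {a, b}" if "e \<in> E" for e
    using HG that unfolding subgraph_def simple_graph_def E_def card_2_iff by blast
  have one: "\<theta> 1 v = v" if v: "v \<in> verts G" for v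
  proof -
    have bij: "bij_betw (\<theta> 1) (verts G) (verts G)"
      using act unfolding free_Z2_action_def graph_automorphism_def Z2_def by blast
    have "\<theta> (1 * 1) v = \<theta> 1 (\<theta> 1 v)"
      using act v unfolding free_Z2_action_def Z2_def by blast
    then have "\<theta> 1 (\<theta> 1 v) = \<theta> 1 v" by simp
    then show ?thesis using bij_betw_imp_inj_on[OF bij] bij_betwE[OF bij] v by (blast dest: inj_onD)
  qed
  have mm: "m (m v) = v" if "v \<in> V" for v
  proof -
    have "v \<in> verts G" using that VG by blast
    then have "\<theta> ((-1) * (-1)) v = \<theta> (-1) (\<theta> (-1) v)"
      using act unfolding free_Z2_action_def Z2_def by blast
    then show ?thesis using one[OF \<open>v \<in> verts G\<close>] by (simp add: m_def)
  qed
  have mne: "m v \<noteq> v" if "v \<in> V" for v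
  proof -
    have "(-1::int) \<in> Z2" "(-1::int) \<noteq> 1" by (simp_all add: Z2_def)
    then show ?thesis using act that VG unfolding free_Z2_action_def m_def by blast
  qed
  have mV: "m v \<in> V" if "v \<in> V" for v
    using inv that unfolding Z2_invariant_def Z2_def m_def V_def by blast
  have mE: "{m a, m b} \<in> E" if "{a, b} \<in> E" for a b
  proof -
    have "(\<lambda>e. m ` e) ` E = E"
      using inv unfolding Z2_invariant_def Z2_def m_def E_def by blast
    then have "m ` {a, b} \<in> E" using that by blast
    then show ?thesis by simp
  qed
  have orb: "vertex_orbit \<theta> v = {v, m v}" for v by (simp add: vertex_orbit_def m_def)
  have orbm: "vertex_orbit \<theta> (m v) = vertex_orbit \<theta> v" if "v \<in> V" for v
    using mm[OF that] by (auto simp: orb)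
  have eorb: "edge_orbit \<theta> {a, b} = {{a, b}, {m a, m b}}" for a b
    by (simp add: edge_orbit_def m_def)
  have ends: "quot_ends \<theta> (edge_orbit \<theta> {a, b}) = {vertex_orbit \<theta> a, vertex_orbit \<theta> b}"
    if "a \<in> V" "b \<in> V" for a b
    using orbm[OF that(1)] orbm[OF that(2)] by (auto simp: quot_ends_def eorb)
  have Rm: "m v \<in> R \<longleftrightarrow> v \<notin> R" if v: "v \<in> V" for v
  proof -
    have "\<exists>!w. w \<in> R \<and> w \<in> {v, m v}"
      using R v VG unfolding orbit_representatives_def orb by blast
    then show ?thesis using mne[OF v] by auto
  qed
  define sg :: "'v \<Rightarrow> int" where "sg v = (if v \<in> R then 1 else -1)" for v
  have sgm: "sg (m v) = - sg v" if "v \<in> V" for v using Rm[OF that] by (simp add: sg_def)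
  have sg2: "sg v * sg v = 1" for v by (simp add: sg_def)
  have gain_eq: "gain R (edge_orbit \<theta> {a, b}) = sg a * sg b" if "a \<in> V" "b \<in> V" for a b
    using Rm[OF that(1)] Rm[OF that(2)] by (auto simp: gain_def eorb sg_def)
  define walk where "walk n w \<longleftrightarrow> w 0 \<in> V \<and> (\<forall>i<n. {w i, w (Suc i)} \<in> E)" for n and w :: "nat \<Rightarrow> 'v"
  have walkV: "w i \<in> V" if "walk n w" "i \<le> n" for n w i
  proof (cases i)
    case 0 then show ?thesis using that by (simp add: walk_def)
  next
    case (Suc k)
    then have "{w k, w (Suc k)} \<in> E" using that by (simp add: walk_def)
    then show ?thesis using EV(2) Suc by blast
  qed
  define P where "P n \<longleftrightarrow> (\<exists>w. walk n w \<and> w n = m (w 0))" for n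
  have noP: "\<not> P n" for n
  proof
    assume "P n"
    define N where "N = (LEAST n. P n)"
    have "P N" using \<open>P n\<close> unfolding N_def by (rule LeastI)
    have least: "\<not> P k" if "k < N" for k using that not_less_Least unfolding N_def by blast
    obtain w where w: "walk N w" "w N = m (w 0)" using \<open>P N\<close> unfolding P_def by blast
    have wV: "w i \<in> V" if "i \<le> N" for i using walkV w(1) that by blast
    have wE: "{w i, w (Suc i)} \<in> E" if "i < N" for i using w(1) that unfolding walk_def by blast
    have Npos: "N > 0" using w(2) mne[OF wV[of 0]] by (cases N) auto
    have inj: "vertex_orbit \<theta> (w i) \<noteq> vertex_orbit \<theta> (w j)" if "i < j" "j < N" for i j
    proof
      assume "vertex_orbit \<theta> (w i) = vertex_orbit \<theta> (w j)"
      then consider "w j = m (w i)" | "w j = w i" unfolding orb by blast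
      then show False
      proof cases
        case 1
        have "walk (j - i) (\<lambda>k. w (i + k))"
          using that wV[of i] wE unfolding walk_def by simp
        then have "P (j - i)" unfolding P_def using 1 that by (intro exI[of _ "\<lambda>k. w (i + k)"]) auto
        then show False using least[of "j - i"] that by auto
      next
        case 2
        define w' where "w' k = (if k \<le> i then w k else w (k + j - i))" for k
        have step: "{w' k, w' (Suc k)} \<in> E" if "k < N - (j - i)" for k
        proof -
          consider "k < i" | "k = i" | "k > i" by linarith
          then show ?thesis
          proof cases
            case 1 then show ?thesis using wE[of k] \<open>i < j\<close> \<open>j < N\<close> by (simp add: w'_def)
          next
            case c: 2
            have "Suc i + j - i = Suc j" by simp
            then show ?thesis using wE[of j] c 2 \<open>j < N\<close> by (simp add: w'_def)
          next
            case 3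
            then have "Suc k + j - i = Suc (k + j - i)" using \<open>i < j\<close> by simp
            then show ?thesis using wE[of "k + j - i"] that 3 \<open>i < j\<close> \<open>j < N\<close> by (simp add: w'_def)
          qed
        qed
        have "walk (N - (j - i)) w'"
          using step wV[of 0] unfolding walk_def by (simp add: w'_def)
        moreover have "w' (N - (j - i)) = m (w' 0)" using w(2) that by (auto simp: w'_def)
        ultimately have "P (N - (j - i))" unfolding P_def by blast
        moreover have "N - (j - i) < N" using that by linarith
        ultimately show False using least by blast
      qed
    qed
    define vo where "vo i = vertex_orbit \<theta> (w i)" for i
    define eo where "eo i = edge_orbit \<theta> {w i, w (Suc i)}" for i
    have vo_inj: "i = j" if "vo i = vo j" "i < N" "j < N" for i j
      using inj[of i j] inj[of j i] that unfolding vo_def by (metis linorder_neqE_nat)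
    have voN: "vo N = vo 0" using w(2) orbm[OF wV[of 0]] by (simp add: vo_def)
    have vomod: "vo (Suc i) = vo (Suc i mod N)" if "i < N" for i
      using that voN by (cases "Suc i = N") auto
    have eends: "quot_ends \<theta> (eo i) = {vo i, vo (Suc i)}" if "i < N" for i
      using ends[OF wV wV] that unfolding eo_def vo_def by simp
    have eo_ne: "eo i \<noteq> eo j" if ij: "i < j" "j < N" for i j
    proof
      assume eq: "eo i = eo j"
      then have e: "{vo i, vo (Suc i)} = {vo j, vo (Suc j mod N)}"
        using eends[of i] eends[of j] vomod[of j] ij by simp
      have "vo i \<noteq> vo j" using vo_inj[of i j] ij by auto
      then have 1: "vo i = vo (Suc j mod N)" and 2: "vo (Suc i) = vo j"
        using e by (auto simp: doubleton_eq_iff)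
      have "j = Suc i" using vo_inj[OF 2] ij by simp
      have "i = Suc j mod N" using vo_inj[OF 1] ij by simp
      then have "Suc j = N" using ij by (cases "Suc j = N") auto
      then have "i = 0" using \<open>i = Suc j mod N\<close> by simp
      then have "j = 1" "N = 2" using \<open>j = Suc i\<close> \<open>Suc j = N\<close> by auto
      have wN: "w (Suc j) = m (w 0)" unfolding \<open>Suc j = N\<close> by (rule w(2))
      have "edge_orbit \<theta> {w 1, m (w 0)} = edge_orbit \<theta> {w 0, w 1}"
        using eq wN unfolding eo_def \<open>i = 0\<close> \<open>j = 1\<close> by simp
      then have "{w 1, m (w 0)} \<in> {{w 0, w 1}, {m (w 0), m (w 1)}}"
        unfolding eorb by (metis insertI1)
      moreover have "w 0 \<in> V" "w 1 \<in> V" using wV[of 0] wV[of 1] \<open>N = 2\<close> by auto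
      ultimately have "w 1 = m (w 0) \<or> w 1 = w 0"
        using mne[of "w 0"] mne[of "w 1"] by (auto simp: doubleton_eq_iff)
      then have "vo 1 = vo 0" using orbm[OF \<open>w 0 \<in> V\<close>] unfolding vo_def by metis
      then show False using vo_inj[of 1 0] \<open>N = 2\<close> by simp
    qed
    have "quot_cycle \<theta> H (map vo [0..<N]) (map eo [0..<N])"
      unfolding quot_cycle_def
    proof (intro conjI allI impI)
      show "map eo [0..<N] \<noteq> []" using Npos by simp
      show "distinct (map vo [0..<N])"
        by (auto simp: distinct_map intro!: inj_onI vo_inj)
      have "i = j" if "eo i = eo j" "i < N" "j < N" for i j
        using eo_ne[of i j] eo_ne[of j i] that by (metis linorder_neqE_nat)
      then show "distinct (map eo [0..<N])"
        by (auto simp: distinct_map intro!: inj_onI)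
      show "set (map vo [0..<N]) \<subseteq> quot_verts \<theta> H"
        using wV by (auto simp: quot_verts_def vo_def V_def)
      show "set (map eo [0..<N]) \<subseteq> quot_edges \<theta> H"
        using wE by (auto simp: quot_edges_def eo_def E_def)
    next
      fix i assume "i < length (map eo [0..<N])"
      then have "i < N" by simp
      then show "quot_ends \<theta> (map eo [0..<N] ! i) =
          {map vo [0..<N] ! i, map vo [0..<N] ! (Suc i mod length (map vo [0..<N]))}"
        using eends[of i] vomod[of i] by simp
    qed simp
    then have prod1: "prod_list (map (gain R) (map eo [0..<N])) = 1"
      using bal unfolding balanced_def by blast
    have "prod_list (map (gain R) (map eo [0..<k])) = sg (w 0) * sg (w k)" if "k \<le> N" for k
      using that
    proof (induction k)
      case 0 then show ?case by (simp add: sg2)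
    next
      case (Suc k)
      have "gain R (eo k) = sg (w k) * sg (w (Suc k))"
        unfolding eo_def using Suc.prems by (intro gain_eq wV) auto
      then have "prod_list (map (gain R) (map eo [0..<Suc k]))
          = (sg (w 0) * sg (w k)) * (sg (w k) * sg (w (Suc k)))" using Suc by simp
      also have "\<dots> = sg (w 0) * (sg (w k) * sg (w k)) * sg (w (Suc k))" by (simp only: ac_simps)
      finally show ?case by (simp only: sg2 mult_1_right)
    qed
    from this[of N] have "sg (w 0) * sg (m (w 0)) = 1" using prod1 w(2) by simp
    then show False using sgm[OF wV[of 0]] sg2[of "w 0"] by simp
  qed
  define A where "A = {(a, b). {a, b} \<in> E}"
  have symA: "sym (A\<^sup>*)" by (rule sym_rtrancl) (auto simp: sym_def A_def insert_commute)
  have no_path: "(v, m v) \<notin> A\<^sup>*" if "v \<in> V" for v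
  proof
    assume "(v, m v) \<in> A\<^sup>*"
    then obtain n where "(v, m v) \<in> A ^^ n" by (auto simp: rtrancl_power)
    then obtain w where "w 0 = v" "w n = m v" "\<forall>i<n. (w i, w (Suc i)) \<in> A"
      unfolding relpow_fun_conv by blast
    then have "P n" using that unfolding P_def walk_def A_def by auto
    then show False using noP by blast
  qed
  define C where "C v = A\<^sup>* `` {v}" for v
  have C_edge: "C a = C b" if "{a, b} \<in> E" for a b
  proof -
    have "(a, b) \<in> A\<^sup>*" "(b, a) \<in> A\<^sup>*" using that by (auto simp: A_def insert_commute)
    then show ?thesis unfolding C_def by (auto intro: rtrancl_trans)
  qed
  have C_ne: "C v \<noteq> C (m v)" if "v \<in> V" for v
    using no_path[OF that] unfolding C_def by blast
  define c where "c Q = (SOME K. K \<in> Q)" for Q :: "'v set set"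
  have c: "c {K, L} = K \<or> c {K, L} = L" for K L
    unfolding c_def by (metis (mono_tags) insertI1 insertE singletonD someI)
  define S where "S = {v \<in> V. c {C v, C (m v)} = C v}"
  have Sm: "m v \<in> S \<longleftrightarrow> v \<notin> S" if "v \<in> V" for v
    using c[of "C v" "C (m v)"] C_ne[OF that] mm[OF that] mV[OF that] that
    by (auto simp: S_def insert_commute)
  have "orbit_representatives \<theta> H S"
    unfolding orbit_representatives_def orb
  proof (intro conjI ballI)
    show "S \<subseteq> verts H" by (auto simp: S_def V_def)
    fix v assume "v \<in> verts H"
    then have "v \<in> V" by (simp add: V_def)
    then show "\<exists>!w. w \<in> S \<and> w \<in> {v, m v}" using Sm[of v] by auto
  qed
  moreover have "gain S F = 1" if F: "F \<in> quot_edges \<theta> H" for F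
  proof -
    obtain e where e: "e \<in> E" "F = edge_orbit \<theta> e" using F by (auto simp: quot_edges_def E_def)
    obtain a b where ab: "e = {a, b}" using E2[OF e(1)] by blast
    have abE: "{a, b} \<in> E" using e(1) ab by simp
    have V: "a \<in> V" "b \<in> V" using EV abE by auto
    have "a \<in> S \<longleftrightarrow> b \<in> S" using C_edge[OF abE] C_edge[OF mE[OF abE]] V by (auto simp: S_def)
    then have "{a, b} \<subseteq> S \<or> {m a, m b} \<subseteq> S" using Sm[OF V(1)] Sm[OF V(2)] by auto
    then show ?thesis by (auto simp: gain_def e(2) ab eorb)
  qed
  ultimately show ?thesis unfolding unit_gain_representatives_def by blast
qed

end

theory Submission
  imports Defs
begin

text \<open>Symmetric and anti-symmetric velocities are treated together: a velocity \<open>u\<close> is twisted by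
  \<open>\<sigma> = \<plusminus>1\<close> if \<open>u (-v) = \<sigma> \<tau>(-1) (u v)\<close> for all \<open>v\<close>. Since \<open>\<tau>(-1)\<close> is a linear isometry, the rates at
  which a twisted velocity changes the lengths of \<open>e\<close> and \<open>-e\<close> agree up to the sign \<open>\<sigma>\<close>
  (\<open>edge_rate_opp\<close>), so each edge orbit imposes a single linear condition on twisted velocities.

  Isostaticity makes these conditions independent in a constructive way. If the orbit of an edge \<open>e\<close> is
  deleted, rigidity is lost, so a nontrivial twisted flex \<open>u\<^sub>e\<close> of the smaller framework appears; the
  full framework being rigid, \<open>u\<^sub>e\<close> must change the length of \<open>e\<close>
  (\<open>isostatic_separating_velocity\<close>). Thus \<open>u\<^sub>e\<close> is detected by the orbit of \<open>e\<close> and by no other.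

  Restricting \<open>u\<^sub>e\<close> to the vertices of a subframework does not alter the rates of its edges. Trivial
  flexes of the subframework have rate 0 on all of them, so the restrictions \<open>u\<^sub>e\<close>, one for each edge
  orbit, together with a basis of the space spanned by the trivial flexes in question are linearly independent
  (\<open>card_plus_dim_le_card_spanning\<close>). It remains to exhibit a space of dimension at most
  \<open>dim X * |V(H\<^sub>0)|\<close> that contains them all. For the first bound this is the space of twisted
  velocities of \<open>H\<close>, which are determined by their values on orbit representatives. For the second,
  it is the space of all velocities of a set \<open>S\<close> of representatives such that each edge orbit has
  a member inside \<open>S\<close>; no twist survives the restriction to \<open>S\<close>, which is why the same bound
  holds in both parts.\<close>

section \<open>Counting linear functionals\<close>

text \<open>Rank-nullity in terms of explicit witnesses: the vectors \<open>u i\<close> are added one at a time to a basis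
  of the span of \<open>T\<close>. Each is new because \<open>L i\<close> vanishes on everything collected before it.\<close>

lemma card_plus_dim_le_card_spanning:
  fixes L :: "'i \<Rightarrow> 'a::real_vector \<Rightarrow> real"
  assumes K: "finite K" and I: "finite I" and lin: "\<And>i. i \<in> I \<Longrightarrow> linear (L i)"
    and T: "T \<subseteq> span K" "\<And>i x. i \<in> I \<Longrightarrow> x \<in> T \<Longrightarrow> L i x = 0"
    and u: "\<And>i. i \<in> I \<Longrightarrow> u i \<in> span K" "\<And>i. i \<in> I \<Longrightarrow> L i (u i) \<noteq> 0"
      "\<And>i j. i \<in> I \<Longrightarrow> j \<in> I \<Longrightarrow> i \<noteq> j \<Longrightarrow> L i (u j) = 0"
  shows "card I + dim T \<le> card K"
proof -
  obtain B where B: "B \<subseteq> T" "independent B" "T \<subseteq> span B"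
    by (rule maximal_independent_subset)
  have dimB: "dim T = card B" using basis_card_eq_dim[OF B(1,3,2)] by simp
  have finB: "finite B" using independent_span_bound[OF K B(2)] B(1) T(1) by blast
  have "finite (B \<union> u ` J) \<and> independent (B \<union> u ` J) \<and> card (B \<union> u ` J) = card B + card J"
    if "J \<subseteq> I" for J
    using finite_subset[OF that I] that
  proof (induction J rule: finite_induct)
    case empty
    then show ?case using B finB by simp
  next
    case (insert i J)
    have "L i x = 0" if "x \<in> span (B \<union> u ` J)" for x
    proof (rule linear_eq_0_on_span[OF lin _ that])
      show "L i y = 0" if "y \<in> B \<union> u ` J" for y
        using that insert.prems insert.hyps B(1) T(2) u(3) by blast
    qed (use insert.prems in blast)
    then have new: "u i \<notin> span (B \<union> u ` J)" using u(2)[of i] insert.prems by blast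
    then have "u i \<notin> B \<union> u ` J" by (meson span_base)
    then show ?case
      using insert independent_insertI[OF new] by simp
  qed
  from this[of I] have *: "independent (B \<union> u ` I)" "card (B \<union> u ` I) = card B + card I"
    by auto
  have "B \<union> u ` I \<subseteq> span K" using B(1) T(1) u(1) by blast
  from independent_span_bound[OF K *(1) this] show ?thesis using *(2) dimB by simp
qed

text \<open>The bound of the previous lemma when every vector of \<open>W\<close> is assembled from one vector of \<open>X\<close> for
  each index in \<open>S\<close>: the images of a basis of \<open>X\<close> under the maps \<open>E v\<close> are a spanning set.\<close>

lemma card_plus_dim_le_card_times_dim:
  fixes L :: "'i \<Rightarrow> 'a::real_vector \<Rightarrow> real" and E :: "'j \<Rightarrow> 'x::real_vector \<Rightarrow> 'a"
  assumes X: "\<exists>B. finite B \<and> span B = (UNIV :: 'x set)"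
    and S: "finite S" and E: "\<And>v. v \<in> S \<Longrightarrow> linear (E v)"
    and W: "\<And>x. x \<in> W \<Longrightarrow> x = (\<Sum>v\<in>S. E v (y x v))"
    and I: "finite I" and lin: "\<And>i. i \<in> I \<Longrightarrow> linear (L i)"
    and T: "T \<subseteq> W" "\<And>i x. i \<in> I \<Longrightarrow> x \<in> T \<Longrightarrow> L i x = 0"
    and u: "\<And>i. i \<in> I \<Longrightarrow> u i \<in> W" "\<And>i. i \<in> I \<Longrightarrow> L i (u i) \<noteq> 0"
      "\<And>i j. i \<in> I \<Longrightarrow> j \<in> I \<Longrightarrow> i \<noteq> j \<Longrightarrow> L i (u j) = 0"
  shows "card I + dim T \<le> dim (UNIV :: 'x set) * card S"
proof -
  obtain B0 where B0: "finite B0" "span B0 = (UNIV :: 'x set)" using X by blast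
  obtain B where "B \<subseteq> (UNIV :: 'x set)" and B: "independent B" "(UNIV :: 'x set) \<subseteq> span B"
    by (rule maximal_independent_subset)
  have finB: "finite B" using independent_span_bound[OF B0(1) B(1)] B0(2) by blast
  have cardB: "card B = dim (UNIV :: 'x set)" using basis_card_eq_dim[OF _ B(2,1)] by simp
  define K where "K = (\<Union>v\<in>S. E v ` B)"
  have finK: "finite K" using S finB by (simp add: K_def)
  have Ein: "E v x \<in> span K" if "v \<in> S" for v x
  proof -
    have "E v x \<in> E v ` span B" using B(2) by blast
    also have "\<dots> = span (E v ` B)" using linear_span_image[OF E[OF that]] by simp
    also have "\<dots> \<subseteq> span K" using that by (intro span_mono) (auto simp: K_def)
    finally show ?thesis .
  qed
  have WK: "W \<subseteq> span K"
  proof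
    fix x assume "x \<in> W"
    have "(\<Sum>v\<in>S. E v (y x v)) \<in> span K" by (rule span_sum) (rule Ein)
    then show "x \<in> span K" using W[OF \<open>x \<in> W\<close>] by simp
  qed
  have "card I + dim T \<le> card K"
    using T u WK by (intro card_plus_dim_le_card_spanning[where L = L and u = u] finK I lin) auto
  also have "card K \<le> (\<Sum>v\<in>S. card (E v ` B))" unfolding K_def by (rule card_UN_le[OF S])
  also have "\<dots> \<le> (\<Sum>v\<in>S. card B)" by (intro sum_mono card_image_le finB)
  finally show ?thesis using cardB by (simp add: mult.commute)
qed

section \<open>Rates of change of edge lengths\<close>

lemma has_vector_derivative_vec_iff:
  fixes f :: "real \<Rightarrow> 'a::real_normed_vector ^ 'n::finite"
  shows "(f has_vector_derivative f') (at t) \<longleftrightarrow>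
    (\<forall>i. ((\<lambda>t. f t $ i) has_vector_derivative f' $ i) (at t))"
proof
  assume "(f has_vector_derivative f') (at t)"
  then show "\<forall>i. ((\<lambda>t. f t $ i) has_vector_derivative f' $ i) (at t)"
    by (blast intro: bounded_linear.has_vector_derivative[OF bounded_linear_vec_nth])
next
  assume *: "\<forall>i. ((\<lambda>t. f t $ i) has_vector_derivative f' $ i) (at t)"
  have "((\<lambda>y. ((f y - f t) - (y - t) *\<^sub>R f') /\<^sub>R norm (y - t)) \<longlongrightarrow> 0) (at t)"
    using * unfolding has_vector_derivative_def has_derivative_at_within
    by (intro vec_tendstoI) simp
  then show "(f has_vector_derivative f') (at t)"
    unfolding has_vector_derivative_def has_derivative_at_within
    by (simp add: bounded_linear_scaleR_left)
qed

definition edge_rate :: "'x::real_normed_vector ^ 'v::finite \<Rightarrow> 'v set \<Rightarrow> 'x ^ 'v \<Rightarrow> real" where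
  "edge_rate p e = frechet_derivative (\<lambda>x. edge_length x e) (at p)"

lemma edge_rate_has_derivative:
  assumes "well_positioned G p" "e \<in> edges G"
  shows "((\<lambda>x. edge_length x e) has_derivative edge_rate p e) (at p)"
proof -
  have "(\<lambda>x. rigidity_map G x $ e) differentiable (at p)"
    using assms(1) unfolding well_positioned_def differentiable_def
    by (blast intro: bounded_linear.has_derivative[OF bounded_linear_vec_nth])
  then show ?thesis
    using assms(2) unfolding edge_rate_def frechet_derivative_works by (simp add: rigidity_map_def)
qed

lemma linear_edge_rate:
  assumes "well_positioned G p" "e \<in> edges G"
  shows "linear (edge_rate p e)"
  using has_derivative_linear[OF edge_rate_has_derivative[OF assms]] .

lemma edge_rate_along_curve:
  assumes "well_positioned G p" "e \<in> edges G"
    and "(c has_vector_derivative u) (at 0)" "c 0 = p"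
  shows "((\<lambda>t. edge_length (c t) e) has_vector_derivative edge_rate p e u) (at 0)"
proof -
  have "((\<lambda>x. edge_length x e) has_derivative edge_rate p e) (at (c 0) within range c)"
    using edge_rate_has_derivative[OF assms(1,2)] assms(4) by (simp add: has_derivative_at_withinI)
  from vector_derivative_diff_chain_within[OF assms(3) this] show ?thesis by (simp add: o_def)
qed

lemma edge_rate_along_line:
  assumes "well_positioned G p" "e \<in> edges G"
  shows "((\<lambda>t. edge_length (p + t *\<^sub>R u) e) has_vector_derivative edge_rate p e u) (at 0)"
proof (rule edge_rate_along_curve[OF assms])
  show "((\<lambda>t. p + t *\<^sub>R u) has_vector_derivative u) (at 0)"
    unfolding has_vector_derivative_def by (auto intro!: derivative_eq_intros)
qed simp

text \<open>This turns symmetries and localities of the lengths themselves into identities between rates, with no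
  formula for the derivative of a norm.\<close>

lemma edge_rate_eqI:
  assumes "well_positioned G p" "e \<in> edges G" "f \<in> edges G"
    and "\<And>t. edge_length (p + t *\<^sub>R u) e = edge_length (p + t *\<^sub>R w) f"
  shows "edge_rate p e u = edge_rate p f w"
  using edge_rate_along_line[OF assms(1,2), of u] edge_rate_along_line[OF assms(1,3), of w]
  unfolding assms(4) by (rule vector_derivative_unique_at)

lemma simple_graph_edgeE:
  assumes "simple_graph G" "e \<in> edges G"
  obtains a b where "e = {a, b}" "a \<in> verts G" "b \<in> verts G"
proof -
  have "e \<subseteq> verts G" "card e = 2" using assms by (auto simp: simple_graph_def)
  then show thesis using that by (auto simp: card_2_iff)
qed

lemma edge_rate_cong:
  assumes "well_positioned G p" "simple_graph G" "e \<in> edges G" "\<And>v. v \<in> e \<Longrightarrow> u $ v = w $ v"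
  shows "edge_rate p e u = edge_rate p e w"
proof (rule edge_rate_eqI[OF assms(1,3,3)])
  obtain a b where "e = {a, b}" using simple_graph_edgeE[OF assms(2,3)] .
  then show "edge_length (p + t *\<^sub>R u) e = edge_length (p + t *\<^sub>R w) e" for t
    using assms(4) by simp
qed

lemma infinitesimal_flex_iff_edge_rate:
  assumes wp: "well_positioned G p" and HG: "edges H \<subseteq> edges G"
  shows "infinitesimal_flex H p u \<longleftrightarrow>
    u \<in> velocities (verts H) \<and> (\<forall>e\<in>edges H. edge_rate p e u = 0)"
proof -
  have "((\<lambda>t. rigidity_map H (p + t *\<^sub>R u) $ e) has_vector_derivative 0) (at 0) \<longleftrightarrow>
      (e \<in> edges H \<longrightarrow> edge_rate p e u = 0)" for e
  proof (cases "e \<in> edges H")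
    case True
    then have "((\<lambda>t. edge_length (p + t *\<^sub>R u) e) has_vector_derivative edge_rate p e u) (at 0)"
      using edge_rate_along_line[OF wp] HG by blast
    then show ?thesis
      using True vector_derivative_unique_at[of _ "edge_rate p e u" 0 0]
      by (auto simp: rigidity_map_def)
  qed (simp add: rigidity_map_def)
  then show ?thesis
    unfolding infinitesimal_flex_def has_vector_derivative_vec_iff by auto
qed

text \<open>Move the vertices of \<open>H\<close> along the rigid motion and leave all others at rest. This curve through \<open>p\<close>
  has velocity \<open>u\<close> and keeps the length of \<open>e\<close> constant near time 0, and the chain rule applies because the length
  is differentiable at \<open>p\<close>.\<close>

lemma trivial_flex_edge_rate_0:
  assumes wp: "well_positioned G p" and G: "simple_graph G"
    and u: "u \<in> trivial_flexes H p" and e: "e \<in> edges G" "e \<subseteq> verts H"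
  shows "edge_rate p e u = 0"
proof -
  obtain \<alpha> where \<alpha>: "rigid_motion \<alpha>"
    and u\<alpha>: "\<And>v. v \<in> verts H \<Longrightarrow> u $ v = vector_derivative (\<alpha> (p $ v)) (at 0)"
    and u0: "\<And>v. v \<notin> verts H \<Longrightarrow> u $ v = 0"
    using u unfolding trivial_flexes_def velocities_def by blast
  have \<alpha>': "(\<alpha> x has_vector_derivative vector_derivative (\<alpha> x) (at 0)) (at 0)" "\<alpha> x 0 = x" for x
    using \<alpha> unfolding rigid_motion_def by (auto simp: vector_derivative_works[symmetric])
  \<comment> \<open>The path \<open>t \<mapsto> \<alpha> (p $ v) t\<close> is continued by rest outside \<open>H\<close>, matching \<open>u $ v = 0\<close> there.\<close>
  define c where "c t = (\<chi> v. if v \<in> verts H then \<alpha> (p $ v) t else p $ v)" for t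
  have c0: "c 0 = p" by (simp add: c_def vec_eq_iff \<alpha>'(2))
  have "((\<lambda>t. c t $ v) has_vector_derivative u $ v) (at 0)" for v
    using \<alpha>'(1) by (cases "v \<in> verts H") (simp_all add: c_def u\<alpha> u0)
  then have "(c has_vector_derivative u) (at 0)" by (simp add: has_vector_derivative_vec_iff)
  from edge_rate_along_curve[OF wp e(1) this c0]
  have 1: "((\<lambda>t. edge_length (c t) e) has_vector_derivative edge_rate p e u) (at 0)" .
  obtain a b where ab: "e = {a, b}" using simple_graph_edgeE[OF G e(1)] .
  have const: "edge_length (c t) e = norm (p $ a - p $ b)" if "t \<in> {-1<..<1}" for t
    using \<alpha> that e(2) unfolding rigid_motion_def by (simp add: ab c_def)
  have "((\<lambda>t. edge_length (c t) e) has_vector_derivative 0) (at 0)"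
    \<comment> \<open>A rigid motion preserves distances only for times in \<open>{-1..1}\<close>.\<close>
    by (rule has_vector_derivative_transform_within_open
        [of "\<lambda>_. norm (p $ a - p $ b)" _ _ "{-1<..<1}"]) (use const in auto)
  from vector_derivative_unique_at[OF 1 this] show ?thesis .
qed

section \<open>Twisted velocities\<close>

text \<open>The factor \<open>\<sigma>\<close> is \<open>1\<close> for symmetric and \<open>-1\<close> for anti-symmetric velocities.\<close>

definition twisted_velocity ::
  "real \<Rightarrow> (int \<Rightarrow> 'v \<Rightarrow> 'v) \<Rightarrow> (int \<Rightarrow> 'x \<Rightarrow> 'x) \<Rightarrow> 'v graph \<Rightarrow> 'x::real_normed_vector ^ 'v::finite \<Rightarrow> bool"
  where
  "twisted_velocity \<sigma> \<theta> \<tau> G u \<longleftrightarrow> (\<forall>v\<in>verts G. u $ \<theta> (-1) v = \<sigma> *\<^sub>R \<tau> (-1) (u $ v))"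

definition twisted_rigid ::
  "real \<Rightarrow> (int \<Rightarrow> 'v \<Rightarrow> 'v) \<Rightarrow> (int \<Rightarrow> 'x \<Rightarrow> 'x) \<Rightarrow> 'v graph \<Rightarrow> 'x::real_normed_vector ^ 'v::finite \<Rightarrow> bool"
  where
  "twisted_rigid \<sigma> \<theta> \<tau> G p \<longleftrightarrow>
     (\<forall>u. infinitesimal_flex G p u \<and> twisted_velocity \<sigma> \<theta> \<tau> G u \<longrightarrow> u \<in> trivial_flexes G p)"

definition twisted_isostatic ::
  "real \<Rightarrow> (int \<Rightarrow> 'v \<Rightarrow> 'v) \<Rightarrow> (int \<Rightarrow> 'x \<Rightarrow> 'x) \<Rightarrow> 'v graph \<Rightarrow> 'x::real_normed_vector ^ 'v::finite \<Rightarrow> bool"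
  where
  "twisted_isostatic \<sigma> \<theta> \<tau> G p \<longleftrightarrow> twisted_rigid \<sigma> \<theta> \<tau> G p \<and>
     \<not> (\<exists>H. subgraph H G \<and> verts H = verts G \<and> H \<noteq> G \<and> Z2_invariant \<theta> H \<and>
            twisted_rigid \<sigma> \<theta> \<tau> H p)"

lemma symmetric_velocity_eq_twisted: "symmetric_velocity = twisted_velocity 1"
  by (intro ext) (simp only: symmetric_velocity_def twisted_velocity_def scaleR_one)

lemma antisymmetric_velocity_eq_twisted: "antisymmetric_velocity = twisted_velocity (-1)"
  by (intro ext) (simp only: antisymmetric_velocity_def twisted_velocity_def scaleR_minus1_left)

lemma symmetrically_isostatic_iff_twisted:
  "symmetrically_isostatic \<theta> \<tau> G p \<longleftrightarrow> twisted_isostatic 1 \<theta> \<tau> G p"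
  unfolding symmetrically_isostatic_def twisted_isostatic_def symmetrically_rigid_def
    twisted_rigid_def symmetric_velocity_eq_twisted ..

lemma antisymmetrically_isostatic_iff_twisted:
  "antisymmetrically_isostatic \<theta> \<tau> G p \<longleftrightarrow> twisted_isostatic (-1) \<theta> \<tau> G p"
  unfolding antisymmetrically_isostatic_def twisted_isostatic_def antisymmetrically_rigid_def
    twisted_rigid_def antisymmetric_velocity_eq_twisted ..

definition restrict_velocity :: "'v set \<Rightarrow> 'x::real_normed_vector ^ 'v::finite \<Rightarrow> 'x ^ 'v" where
  "restrict_velocity U u = (\<chi> v. if v \<in> U then u $ v else 0)"

lemma restrict_velocity_in_velocities: "restrict_velocity U u \<in> velocities U"
  by (simp add: restrict_velocity_def velocities_def)

text \<open>The twisted velocity that is supported on the orbit of \<open>v\<close> and has the value \<open>x\<close> at \<open>v\<close>.\<close>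

definition orbit_velocity ::
  "real \<Rightarrow> (int \<Rightarrow> 'v \<Rightarrow> 'v) \<Rightarrow> (int \<Rightarrow> 'x \<Rightarrow> 'x) \<Rightarrow> 'v \<Rightarrow> 'x \<Rightarrow> 'x::real_normed_vector ^ 'v::finite" where
  "orbit_velocity \<sigma> \<theta> \<tau> v x =
     (\<chi> w. if w = v then x else if w = \<theta> (-1) v then \<sigma> *\<^sub>R \<tau> (-1) x else 0)"

lemma linear_orbit_velocity:
  assumes "linear (\<tau> (-1))"
  shows "linear (orbit_velocity \<sigma> \<theta> \<tau> v)"
  by (rule linearI)
    (auto simp: orbit_velocity_def vec_eq_iff linear_add[OF assms] linear_scale[OF assms] scaleR_add_right)

lemma linear_axis: "linear (axis v :: 'x::real_vector \<Rightarrow> 'x ^ 'v::finite)"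
  by (rule linearI) (auto simp: axis_def vec_eq_iff)

lemma velocity_eq_sum_axis:
  assumes "u \<in> velocities S"
  shows "u = (\<Sum>v\<in>S. axis v (u $ v))"
proof -
  have "(\<Sum>v\<in>S. axis v (u $ v) $ w) = (\<Sum>v\<in>S. if w = v then u $ v else 0)" for w
    by (simp add: axis_def)
  then show ?thesis using assms by (simp add: vec_eq_iff velocities_def)
qed

section \<open>Symmetric frameworks\<close>

locale symmetric_framework =
  fixes G :: "'v::finite graph" and p :: "'x::real_normed_vector ^ 'v"
    and \<theta> :: "int \<Rightarrow> 'v \<Rightarrow> 'v" and \<tau> :: "int \<Rightarrow> 'x \<Rightarrow> 'x"
  assumes action: "free_Z2_action \<theta> G" and representation: "Z2_representation \<tau>"
    and framework: "framework G p" and well_positioned: "well_positioned G p"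
    and symmetric: "Z2_symmetric \<theta> \<tau> G p"
begin

abbreviation opp :: "'v \<Rightarrow> 'v" where "opp \<equiv> \<theta> (-1)"

lemma simple: "simple_graph G"
  using framework by (simp add: framework_def)

lemma linear_\<tau>: "linear (\<tau> (-1))" and norm_\<tau>: "norm (\<tau> (-1) x) = norm x"
proof -
  have "linear (\<tau> (-1)) \<and> (\<forall>x. norm (\<tau> (-1) x) = norm x)"
    using representation unfolding Z2_representation_def Z2_def by blast
  then show "linear (\<tau> (-1))" "norm (\<tau> (-1) x) = norm x" by blast+
qed

lemma automorphism: "s \<in> Z2 \<Longrightarrow> graph_automorphism G (\<theta> s)"
  using action unfolding free_Z2_action_def by blast

text \<open>As \<open>\<theta> 1\<close> is injective, \<open>\<theta> 1 (\<theta> 1 v) = \<theta> (1 * 1) v\<close> forces it to be the identity.\<close>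

lemma \<theta>_1: "v \<in> verts G \<Longrightarrow> \<theta> 1 v = v"
proof -
  assume v: "v \<in> verts G"
  have bij: "bij_betw (\<theta> 1) (verts G) (verts G)"
    using automorphism[of 1] unfolding graph_automorphism_def Z2_def by blast
  have "\<theta> (1 * 1) v = \<theta> 1 (\<theta> 1 v)"
    using action v unfolding free_Z2_action_def Z2_def by blast
  then have "\<theta> 1 (\<theta> 1 v) = \<theta> 1 v" by simp
  then show ?thesis using bij_betw_imp_inj_on[OF bij] bij_betwE[OF bij] v by (blast dest: inj_onD)
qed

lemma opp_opp: "v \<in> verts G \<Longrightarrow> opp (opp v) = v"
proof -
  assume v: "v \<in> verts G"
  have "\<theta> ((-1) * (-1)) v = opp (opp v)"
    using action v unfolding free_Z2_action_def Z2_def by blast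
  then show ?thesis using \<theta>_1[OF v] by simp
qed

lemma opp_neq: "v \<in> verts G \<Longrightarrow> opp v \<noteq> v"
proof -
  assume v: "v \<in> verts G"
  have "(-1::int) \<in> Z2" "(-1::int) \<noteq> 1" by (simp_all add: Z2_def)
  then show ?thesis using action v unfolding free_Z2_action_def by blast
qed

lemma edge_subset: "e \<in> edges G \<Longrightarrow> e \<subseteq> verts G"
  using simple by (simp add: simple_graph_def)

lemma opp_edge: "e \<in> edges G \<Longrightarrow> opp ` e \<in> edges G"
proof -
  assume e: "e \<in> edges G"
  obtain a b where "e = {a, b}" "a \<in> verts G" "b \<in> verts G"
    using simple_graph_edgeE[OF simple e] .
  moreover have "\<forall>v\<in>verts G. \<forall>w\<in>verts G. {v, w} \<in> edges G \<longleftrightarrow> {opp v, opp w} \<in> edges G"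
    using automorphism[of "-1"] unfolding graph_automorphism_def Z2_def by blast
  ultimately show ?thesis using e by (metis image_empty image_insert)
qed

lemma opp_opp_edge: "e \<in> edges G \<Longrightarrow> opp ` opp ` e = e"
proof -
  assume e: "e \<in> edges G"
  obtain a b where "e = {a, b}" "a \<in> verts G" "b \<in> verts G"
    using simple_graph_edgeE[OF simple e] .
  then show ?thesis by (simp add: opp_opp)
qed

lemma edge_orbit_eq: "e \<in> edges G \<Longrightarrow> f \<in> edge_orbit \<theta> e \<Longrightarrow> edge_orbit \<theta> f = edge_orbit \<theta> e"
  using opp_opp_edge[of e] by (auto simp: edge_orbit_def)

text \<open>Displacing along \<open>u\<close> for time \<open>t\<close> changes the length of \<open>-e\<close> as displacing along \<open>\<sigma> u\<close> changes that
  of \<open>e\<close>, because \<open>\<tau>(-1)\<close> carries the second displaced edge onto the first. For a fixed edge and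
  \<open>\<sigma> = -1\<close> the rate is therefore 0.\<close>

lemma edge_rate_opp:
  assumes e: "e \<in> edges G" and u: "twisted_velocity \<sigma> \<theta> \<tau> G u"
  shows "edge_rate p (opp ` e) u = \<sigma> * edge_rate p e u"
proof -
  obtain a b where ab: "e = {a, b}" "a \<in> verts G" "b \<in> verts G"
    using simple_graph_edgeE[OF simple e] .
  have p: "p $ opp v = \<tau> (-1) (p $ v)" "u $ opp v = \<sigma> *\<^sub>R \<tau> (-1) (u $ v)" if "v \<in> verts G" for v
    using symmetric u that by (simp_all add: Z2_symmetric_def twisted_velocity_def)
  have "edge_rate p (opp ` e) u = edge_rate p e (\<sigma> *\<^sub>R u)"
  proof (rule edge_rate_eqI[OF well_positioned opp_edge[OF e] e])
    fix t
    have "edge_length (p + t *\<^sub>R u) (opp ` e) =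
        norm (\<tau> (-1) ((p $ a + t *\<^sub>R \<sigma> *\<^sub>R u $ a) - (p $ b + t *\<^sub>R \<sigma> *\<^sub>R u $ b)))"
      by (simp add: ab p linear_diff[OF linear_\<tau>] linear_add[OF linear_\<tau>] linear_scale[OF linear_\<tau>])
    then show "edge_length (p + t *\<^sub>R u) (opp ` e) = edge_length (p + t *\<^sub>R \<sigma> *\<^sub>R u) e"
      by (simp add: ab norm_\<tau>)
  qed
  also have "\<dots> = \<sigma> * edge_rate p e u"
    using linear_scale[OF linear_edge_rate[OF well_positioned e]] by simp
  finally show ?thesis .
qed

lemma delete_edge_orbit_invariant:
  assumes e: "e \<in> edges G"
  shows "Z2_invariant \<theta> (Graph (verts G) (edges G - edge_orbit \<theta> e))"
proof -
  have one: "\<theta> 1 ` f = f" if "f \<subseteq> verts G" for f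
    using that \<theta>_1 by (force simp: subset_iff)
  have "opp ` verts G = verts G"
    using automorphism[of "-1"] unfolding graph_automorphism_def Z2_def bij_betw_def by blast
  moreover have "\<theta> 1 ` verts G = verts G" using one by blast
  moreover have "(\<lambda>f. \<theta> 1 ` f) ` (edges G - edge_orbit \<theta> e) = edges G - edge_orbit \<theta> e"
    using one edge_subset by (force simp: image_iff)
  moreover have "(\<lambda>f. opp ` f) ` (edges G - edge_orbit \<theta> e) = edges G - edge_orbit \<theta> e"
  proof -
    have sub: "opp ` f \<in> edges G - edge_orbit \<theta> e" if f: "f \<in> edges G - edge_orbit \<theta> e" for f
    proof -
      have "f \<in> edge_orbit \<theta> e" if o: "opp ` f \<in> edge_orbit \<theta> e"
      proof -
        have "edge_orbit \<theta> e = edge_orbit \<theta> (opp ` f)" using edge_orbit_eq[OF e o] by simp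
        then show ?thesis using opp_opp_edge[of f] f by (simp add: edge_orbit_def)
      qed
      then show ?thesis using f opp_edge by blast
    qed
    show ?thesis
    proof
      show "edges G - edge_orbit \<theta> e \<subseteq> (\<lambda>f. opp ` f) ` (edges G - edge_orbit \<theta> e)"
        using sub opp_opp_edge by (metis (no_types, lifting) DiffD1 image_eqI subsetI)
    qed (use sub in blast)
  qed
  ultimately show ?thesis by (simp add: Z2_invariant_def Z2_def)
qed

text \<open>By minimality, deleting the orbit of \<open>e\<close> creates a nontrivial twisted flex. The vertex set and with
  it the trivial flexes are the same as before, so by rigidity this cannot be a flex of \<open>G\<close>.\<close>

lemma isostatic_separating_velocity:
  assumes iso: "twisted_isostatic \<sigma> \<theta> \<tau> G p" and e: "e \<in> edges G"
  shows "\<exists>u. twisted_velocity \<sigma> \<theta> \<tau> G u \<and> edge_rate p e u \<noteq> 0 \<and>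
    (\<forall>f\<in>edges G - edge_orbit \<theta> e. edge_rate p f u = 0)"
proof -
  define G' where "G' = Graph (verts G) (edges G - edge_orbit \<theta> e)"
  have "subgraph G' G" using simple by (auto simp: G'_def subgraph_def simple_graph_def)
  moreover have "verts G' = verts G" "edges G' \<noteq> edges G"
    using e by (auto simp: G'_def edge_orbit_def)
  ultimately have "\<not> twisted_rigid \<sigma> \<theta> \<tau> G' p"
    using iso delete_edge_orbit_invariant[OF e] unfolding twisted_isostatic_def G'_def by metis
  then obtain u where u: "infinitesimal_flex G' p u" "twisted_velocity \<sigma> \<theta> \<tau> G u"
      "u \<notin> trivial_flexes G p"
    by (auto simp: twisted_rigid_def twisted_velocity_def trivial_flexes_def G'_def)
  have rates: "u \<in> velocities (verts G)" "\<forall>f\<in>edges G - edge_orbit \<theta> e. edge_rate p f u = 0"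
    using u(1) infinitesimal_flex_iff_edge_rate[OF well_positioned, of G' u]
    by (auto simp: G'_def)
  have "\<not> infinitesimal_flex G p u"
    using iso u unfolding twisted_isostatic_def twisted_rigid_def by blast
  \<comment> \<open>Some edge of \<open>G\<close> changes its length. It lies in the deleted orbit, hence is \<open>e\<close> or \<open>-e\<close>.\<close>
  then obtain f where "f \<in> edges G" "edge_rate p f u \<noteq> 0"
    using infinitesimal_flex_iff_edge_rate[OF well_positioned, of G u] rates(1) by blast
  then have "f \<in> edge_orbit \<theta> e" "edge_rate p f u \<noteq> 0" using rates(2) by auto
  then have "edge_rate p e u \<noteq> 0" using edge_rate_opp[OF e u(2)] by (auto simp: edge_orbit_def)
  then show ?thesis using u(2) rates(2) by blast
qed

text \<open>The common core of the bounds. \<open>A\<close> has at most one edge from each orbit, \<open>K\<close> is the graph whose trivial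
  flexes are counted, and \<open>W\<close> is the space in which the count takes place.\<close>

lemma isostatic_edge_count:
  assumes iso: "twisted_isostatic \<sigma> \<theta> \<tau> G p"
    and X: "\<exists>B. finite B \<and> span B = (UNIV :: 'x set)"
    and E: "\<And>v. v \<in> S \<Longrightarrow> linear (E v :: 'x \<Rightarrow> 'x ^ 'v)"
    and W: "\<And>u. u \<in> W \<Longrightarrow> u = (\<Sum>v\<in>S. E v (u $ v))"
    and res: "\<And>u. twisted_velocity \<sigma> \<theta> \<tau> G u \<Longrightarrow> restrict_velocity (verts K) u \<in> W"
    and A: "A \<subseteq> edges G" "\<And>e. e \<in> A \<Longrightarrow> e \<subseteq> verts K" "inj_on (edge_orbit \<theta>) A"
    and T: "T \<subseteq> W" "T \<subseteq> trivial_flexes K p"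
  shows "card A + dim T \<le> dim (UNIV :: 'x set) * card S"
proof -
  obtain u where u: "\<And>e. e \<in> edges G \<Longrightarrow> twisted_velocity \<sigma> \<theta> \<tau> G (u e)"
      "\<And>e. e \<in> edges G \<Longrightarrow> edge_rate p e (u e) \<noteq> 0"
      "\<And>e f. e \<in> edges G \<Longrightarrow> f \<in> edges G - edge_orbit \<theta> e \<Longrightarrow> edge_rate p f (u e) = 0"
    using isostatic_separating_velocity[OF iso] by metis
  have rate: "edge_rate p e (restrict_velocity (verts K) w) = edge_rate p e w" if "e \<in> A" for e w
    using that A by (intro edge_rate_cong[OF well_positioned simple]) (auto simp: restrict_velocity_def)
  show ?thesis
  proof (rule card_plus_dim_le_card_times_dim
      [where L = "edge_rate p" and u = "\<lambda>e. restrict_velocity (verts K) (u e)" and y = "($)", OF X _ E W])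
    show "linear (edge_rate p e)" if "e \<in> A" for e
      using linear_edge_rate[OF well_positioned] that A(1) by blast
    show "edge_rate p e x = 0" if "e \<in> A" "x \<in> T" for e x
      using trivial_flex_edge_rate_0[OF well_positioned simple] that A T(2) by blast
    show "edge_rate p e (restrict_velocity (verts K) (u f)) = 0"
      if "e \<in> A" "f \<in> A" "e \<noteq> f" for e f
    proof -
      have "e \<notin> edge_orbit \<theta> f"
        using edge_orbit_eq[of f e] that A(1,3) by (auto dest: inj_onD)
      then show ?thesis using u(3)[of f e] that A(1) rate by auto
    qed
  qed (use rate res u A T in auto)
qed

lemma card_representatives_le:
  assumes "subgraph H G" "orbit_representatives \<theta> H S"
  shows "card S \<le> card (quot_verts \<theta> H)"
proof -
  have "inj_on (vertex_orbit \<theta>) S"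
  proof (rule inj_onI)
    fix v w assume "v \<in> S" "w \<in> S" "vertex_orbit \<theta> v = vertex_orbit \<theta> w"
    moreover have "v \<in> vertex_orbit \<theta> v" "w \<in> vertex_orbit \<theta> w" by (auto simp: vertex_orbit_def)
    ultimately show "v = w" using assms(2) unfolding orbit_representatives_def by blast
  qed
  moreover have "vertex_orbit \<theta> ` S \<subseteq> quot_verts \<theta> H"
    using assms(2) by (auto simp: orbit_representatives_def quot_verts_def)
  ultimately show ?thesis by (metis card_image card_mono finite)
qed

text \<open>The orbits are disjoint, and as the action is free, each consists of one vertex of \<open>S\<close> and another
  vertex outside \<open>S\<close>, at which the twist determines the value of \<open>u\<close>.\<close>

lemma twisted_velocity_eq_sum_orbit_velocity:
  assumes H: "subgraph H G" and S: "orbit_representatives \<theta> H S"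
    and u: "u \<in> velocities (verts H)" "twisted_velocity \<sigma> \<theta> \<tau> H u"
    and inv: "\<And>v. v \<in> verts H \<Longrightarrow> opp v \<in> verts H"
  shows "u = (\<Sum>v\<in>S. orbit_velocity \<sigma> \<theta> \<tau> v (u $ v))"
proof -
  have SH: "S \<subseteq> verts H" and ex1: "\<And>v. v \<in> verts H \<Longrightarrow> \<exists>!w. w \<in> S \<and> w \<in> {v, opp v}"
    using S by (auto simp: orbit_representatives_def vertex_orbit_def)
  have VG: "v \<in> verts G" if "v \<in> verts H" for v using H that by (auto simp: subgraph_def)
  have *: "(\<Sum>v\<in>S. orbit_velocity \<sigma> \<theta> \<tau> v (u $ v) $ w) = u $ w" for w
  proof -
    consider "w \<in> S" | "w \<in> verts H" "opp w \<in> S" "w \<notin> S" | "w \<notin> verts H"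
      using ex1[of w] by blast
    then show ?thesis
    proof cases
      case 1
      have "orbit_velocity \<sigma> \<theta> \<tau> v (u $ v) $ w = (if v = w then u $ v else 0)" if "v \<in> S" for v
        using ex1[of v] 1 that SH opp_neq[of v] VG[of v] by (auto simp: orbit_velocity_def)
      then show ?thesis using 1 by simp
    next
      case 2
      have "orbit_velocity \<sigma> \<theta> \<tau> v (u $ v) $ w = (if v = opp w then u $ w else 0)" if "v \<in> S" for v
      proof -
        have "w = opp v \<longleftrightarrow> v = opp w" using opp_opp VG SH that 2 by auto
        moreover have "u $ opp v = \<sigma> *\<^sub>R \<tau> (-1) (u $ v)"
          using u(2) that SH by (auto simp: twisted_velocity_def)
        ultimately show ?thesis using that 2 by (auto simp: orbit_velocity_def)
      qed
      then show ?thesis using 2 by simp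
    next
      case 3
      have "orbit_velocity \<sigma> \<theta> \<tau> v (u $ v) $ w = 0" if "v \<in> S" for v
        using 3 that SH inv[of v] by (auto simp: orbit_velocity_def)
      then show ?thesis using 3 u(1) by (simp add: velocities_def)
    qed
  qed
  then show ?thesis by (simp add: vec_eq_iff)
qed

text \<open>The representatives of the vertex orbits of \<open>H\<close> are those of \<open>G\<close> that lie in \<open>H\<close>: an invariant
  subgraph contains each orbit that it meets.\<close>

lemma twisted_isostatic_count:
  assumes iso: "twisted_isostatic \<sigma> \<theta> \<tau> G p"
    and X: "\<exists>B. finite B \<and> span B = (UNIV :: 'x set)"
    and R: "orbit_representatives \<theta> G R" and H: "subgraph H G" and inv: "Z2_invariant \<theta> H"
  shows "card (quot_edges \<theta> H) + dim {u \<in> trivial_flexes H p. twisted_velocity \<sigma> \<theta> \<tau> H u}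
    \<le> dim (UNIV :: 'x set) * card (quot_verts \<theta> H)"
proof -
  have VG: "verts H \<subseteq> verts G" and EG: "edges H \<subseteq> edges G" and EV: "\<forall>e\<in>edges H. e \<subseteq> verts H"
    using H unfolding subgraph_def simple_graph_def by blast+
  have oppH: "opp v \<in> verts H" if "v \<in> verts H" for v
    using inv that unfolding Z2_invariant_def Z2_def by blast
  define S where "S = R \<inter> verts H"
  have S: "orbit_representatives \<theta> H S"
    unfolding orbit_representatives_def
  proof (intro conjI ballI)
    fix v assume v: "v \<in> verts H"
    then have "v \<in> verts G" using VG by blast
    with R have "\<exists>!w. w \<in> R \<and> w \<in> vertex_orbit \<theta> v"
      unfolding orbit_representatives_def by (elim conjE) (rule bspec)
    moreover have "vertex_orbit \<theta> v \<subseteq> verts H" using v oppH by (simp add: vertex_orbit_def)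
    ultimately show "\<exists>!w. w \<in> S \<and> w \<in> vertex_orbit \<theta> v" unfolding S_def by blast
  qed (simp add: S_def)
  obtain A where A: "A \<subseteq> edges H" "inj_on (edge_orbit \<theta>) A" "quot_edges \<theta> H = edge_orbit \<theta> ` A"
    using subset_image_inj[of "quot_edges \<theta> H" "edge_orbit \<theta>" "edges H"]
    by (auto simp: quot_edges_def)
  have "card A + dim {u \<in> trivial_flexes H p. twisted_velocity \<sigma> \<theta> \<tau> H u}
      \<le> dim (UNIV :: 'x set) * card S"
  proof (rule isostatic_edge_count[OF iso X,
        where E = "orbit_velocity \<sigma> \<theta> \<tau>" and K = H
        and W = "{u \<in> velocities (verts H). twisted_velocity \<sigma> \<theta> \<tau> H u}"])
    show "u = (\<Sum>v\<in>S. orbit_velocity \<sigma> \<theta> \<tau> v (u $ v))"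
      if "u \<in> {u \<in> velocities (verts H). twisted_velocity \<sigma> \<theta> \<tau> H u}" for u
      using twisted_velocity_eq_sum_orbit_velocity[OF H S _ _ oppH] that by blast
    show "restrict_velocity (verts H) u \<in> {u \<in> velocities (verts H). twisted_velocity \<sigma> \<theta> \<tau> H u}"
      if "twisted_velocity \<sigma> \<theta> \<tau> G u" for u
      using that VG oppH restrict_velocity_in_velocities[of "verts H" u]
      by (auto simp: twisted_velocity_def restrict_velocity_def)
  qed (use A EG EV linear_orbit_velocity[of \<tau>, OF linear_\<tau>] in \<open>auto simp: trivial_flexes_def\<close>)
  also have "\<dots> \<le> dim (UNIV :: 'x set) * card (quot_verts \<theta> H)"
    using card_representatives_le[OF H S] by simp
  finally show ?thesis using A(2,3) by (simp add: card_image)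
qed

text \<open>An edge orbit of gain 1 has a member inside \<open>S\<close>, which represents it in the induced subgraph. The twist
  does not relate the values at different members of \<open>S\<close>, so that \<open>axis v\<close> takes the place of
  \<open>orbit_velocity \<sigma> \<theta> \<tau> v\<close>.\<close>

lemma unit_gain_count:
  assumes iso: "twisted_isostatic \<sigma> \<theta> \<tau> G p"
    and X: "\<exists>B. finite B \<and> span B = (UNIV :: 'x set)"
    and H: "subgraph H G" and inv: "Z2_invariant \<theta> H" and S: "unit_gain_representatives \<theta> H S"
  shows "card (quot_edges \<theta> H) + dim (trivial_flexes (induced_subgraph H S) p)
    \<le> dim (UNIV :: 'x set) * card (quot_verts \<theta> H)"
proof -
  have rep: "orbit_representatives \<theta> H S" using S by (simp add: unit_gain_representatives_def)
  then have vS: "verts (induced_subgraph H S) = S"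
    by (auto simp: orbit_representatives_def induced_subgraph_def)
  have "quot_edges \<theta> H \<subseteq> edge_orbit \<theta> ` {e \<in> edges H. e \<subseteq> S}"
  proof
    fix F assume F: "F \<in> quot_edges \<theta> H"
    then obtain f where f: "f \<in> edges H" "F = edge_orbit \<theta> f" by (auto simp: quot_edges_def)
    have "gain S F = 1" using S F by (simp add: unit_gain_representatives_def)
    then obtain e where e: "e \<in> F" "e \<subseteq> S" by (auto simp: gain_def split: if_splits)
    have "F \<subseteq> edges H" using inv f unfolding Z2_invariant_def Z2_def edge_orbit_def by blast
    moreover have "edge_orbit \<theta> e = F"
      using edge_orbit_eq[of f e] e(1) f H by (auto simp: subgraph_def)
    ultimately show "F \<in> edge_orbit \<theta> ` {e \<in> edges H. e \<subseteq> S}" using e by blast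
  qed
  then obtain A where A: "A \<subseteq> {e \<in> edges H. e \<subseteq> S}" "inj_on (edge_orbit \<theta>) A"
      "quot_edges \<theta> H = edge_orbit \<theta> ` A"
    unfolding subset_image_inj by blast
  have "card A + dim (trivial_flexes (induced_subgraph H S) p) \<le> dim (UNIV :: 'x set) * card S"
  proof (rule isostatic_edge_count[OF iso X,
        where E = axis and K = "induced_subgraph H S" and W = "velocities S"])
    show "A \<subseteq> edges G" using A(1) H by (auto simp: subgraph_def)
  qed (use A vS velocity_eq_sum_axis linear_axis restrict_velocity_in_velocities
      in \<open>auto simp: trivial_flexes_def\<close>)
  also have "\<dots> \<le> dim (UNIV :: 'x set) * card (quot_verts \<theta> H)"
    using card_representatives_le[OF H rep] by simp
  finally show ?thesis using A(2,3) by (simp add: card_image)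
qed

end

theorem lemma13:
  fixes G H :: "'v::finite graph" and p :: "'x::real_normed_vector ^ 'v"
    and \<theta> :: "int \<Rightarrow> 'v \<Rightarrow> 'v" and \<tau> :: "int \<Rightarrow> 'x \<Rightarrow> 'x" and R :: "'v set"
  assumes "\<exists>B. finite B \<and> span B = (UNIV :: 'x set)"
    and "free_Z2_action \<theta> G"
    and "orbit_representatives \<theta> G R"
    and "Z2_representation \<tau>"
    and "framework G p"
    and "well_positioned G p"
    and "Z2_symmetric \<theta> \<tau> G p"
    and "subgraph H G"
    and "Z2_invariant \<theta> H"
  shows
    "(symmetrically_isostatic \<theta> \<tau> G p \<longrightarrow>
        int (card (quot_edges \<theta> H)) \<le>
          int (dim (UNIV :: 'x set)) * int (card (quot_verts \<theta> H))
          - int (dim (symmetric_trivial_flexes \<theta> \<tau> H p)) \<and>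
        (balanced \<theta> R H \<longrightarrow>
          (\<forall>S. unit_gain_representatives \<theta> H S \<longrightarrow>
             int (card (quot_edges \<theta> H)) \<le>
               int (dim (UNIV :: 'x set)) * int (card (quot_verts \<theta> H))
               - int (dim (trivial_flexes (induced_subgraph H S) p)))))
     \<and>
     (antisymmetrically_isostatic \<theta> \<tau> G p \<longrightarrow>
        int (card (quot_edges \<theta> H)) \<le>
          int (dim (UNIV :: 'x set)) * int (card (quot_verts \<theta> H))
          - int (dim (antisymmetric_trivial_flexes \<theta> \<tau> H p)) \<and>
        (balanced \<theta> R H \<longrightarrow>
          (\<forall>S. unit_gain_representatives \<theta> H S \<longrightarrow>
             int (card (quot_edges \<theta> H)) \<le>
               int (dim (UNIV :: 'x set)) * int (card (quot_verts \<theta> H))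
               - int (dim (trivial_flexes (induced_subgraph H S) p)))))"
proof -
  interpret symmetric_framework G p \<theta> \<tau>
    using assms by unfold_locales
  have *: "int k \<le> int d * int n - int t" if "k + t \<le> d * n" for k t d n
    using that by (metis of_nat_add of_nat_mult of_nat_le_iff le_diff_eq)
  show ?thesis
    unfolding symmetrically_isostatic_iff_twisted antisymmetrically_isostatic_iff_twisted
      symmetric_trivial_flexes_def antisymmetric_trivial_flexes_def
      symmetric_velocity_eq_twisted antisymmetric_velocity_eq_twisted
    using *[OF twisted_isostatic_count[OF _ assms(1,3,8,9)]]
      *[OF unit_gain_count[OF _ assms(1,8,9)]]
    by blast
qed

end
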